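(* Let $P$ be a probability measure (the joint law of $(X,Y)\in\mathcal X\times\{0,1\}$). For any measurable $f:\mathcal X\to[0,1]$ and any measurable $h:[0,1]\to[0,1]$, $$R_P(h;f)=R^{\mathrm{cal}}_P(h;f)+R^{\mathrm{sha}}_P(h;f).$$
   Context: $\mathcal X\subset\mathbb R^d$. The recalibration risk, calibration risk and sharpness risk of $h$ over $f$ under $P$ are, respectively, $$R_P(h;f)=\mathbb E_P\big[(h\circ f(X)-\mathbb E_P[Y\mid f(X)])^2\big],$$ $$R^{\mathrm{cal}}_P(h;f)=\mathbb E_P\big[(h\circ f(X)-\mathbb E_P[Y\mid h\circ f(X)])^2\big],$$ $$R^{\mathrm{sha}}_P(h;f)=\mathbb E_P\big[(\mathbb E_P[Y\mid h\circ f(X)]-\mathbb E_P[Y\mid f(X)])^2\big].$$ *)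

theory Defs
  imports "HOL-Probability.Probability"
begin

text \<open>
  \<open>\<X> \<times> {0, 1}\<close> for an arbitrary \<open>\<X> \<subseteq> \<real>\<^sup>d\<close>: \<open>\<X>\<close> carries the trace of the Borel sets
  (\<open>\<X>\<close> itself need not be Borel) and the labels are the reals 0 and 1.
\<close>

definition sample_space :: "(real ^ 'd) set \<Rightarrow> ((real ^ 'd) \<times> real) measure" where
  "sample_space \<X> = restrict_space borel \<X> \<Otimes>\<^sub>M count_space {0, 1}"

text \<open>
  A version of \<open>E\<^sub>P[Y | Z]\<close>, the conditioning being on the \<open>\<sigma>\<close>-algebra generated by \<open>Z\<close>; it is
  unique only \<open>P\<close>-almost surely, which does not affect the integrals below. As \<open>real_cond_exp\<close>
  is meaningful only for a sub-\<open>\<sigma>\<close>-algebra of \<open>P\<close>, \<open>Z\<close> has to be Borel measurable on \<open>P\<close>.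
\<close>

definition cond_exp_given :: "'a measure \<Rightarrow> ('a \<Rightarrow> real) \<Rightarrow> ('a \<Rightarrow> real) \<Rightarrow> 'a \<Rightarrow> real" where
  "cond_exp_given P Y Z = real_cond_exp P (vimage_algebra (space P) Z borel) Y"

text \<open>
  In the risks below \<open>P\<close> is the joint law of \<open>(X, Y)\<close>, so \<open>X\<close> and \<open>Y\<close> are the coordinate
  maps \<open>fst\<close> and \<open>snd\<close>.
\<close>

definition recal_risk ::
    "('x \<times> real) measure \<Rightarrow> (real \<Rightarrow> real) \<Rightarrow> ('x \<Rightarrow> real) \<Rightarrow> real" where
  "recal_risk P h f =
     (\<integral>\<omega>. (h (f (fst \<omega>)) - cond_exp_given P snd (f \<circ> fst) \<omega>)\<^sup>2 \<partial>P)"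

definition cal_risk ::
    "('x \<times> real) measure \<Rightarrow> (real \<Rightarrow> real) \<Rightarrow> ('x \<Rightarrow> real) \<Rightarrow> real" where
  "cal_risk P h f =
     (\<integral>\<omega>. (h (f (fst \<omega>)) - cond_exp_given P snd (h \<circ> f \<circ> fst) \<omega>)\<^sup>2 \<partial>P)"

definition sha_risk ::
    "('x \<times> real) measure \<Rightarrow> (real \<Rightarrow> real) \<Rightarrow> ('x \<Rightarrow> real) \<Rightarrow> real" where
  "sha_risk P h f =
     (\<integral>\<omega>. (cond_exp_given P snd (h \<circ> f \<circ> fst) \<omega> - cond_exp_given P snd (f \<circ> fst) \<omega>)\<^sup>2 \<partial>P)"

end

theory Submission
  imports Defs
begin

text \<open>
  Write \<open>A = E[Y | f(X)]\<close>, \<open>B = E[Y | h(f(X))]\<close> and \<open>W = h(f(X))\<close>. Since \<open>W - B\<close> is measurable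
  with respect to both conditioning \<open>\<sigma>\<close>-algebras, \<open>E[(W - B) A] = E[(W - B) Y] = E[(W - B) B]\<close>,
  so the cross term in the expansion of \<open>((W - B) + (B - A))\<^sup>2\<close> has integral zero.
\<close>

lemma integrable_mult_of_square_integrable:
  fixes u v :: "'a \<Rightarrow> real"
  assumes [measurable]: "u \<in> borel_measurable M" "v \<in> borel_measurable M"
    and "integrable M (\<lambda>x. (u x)\<^sup>2)" "integrable M (\<lambda>x. (v x)\<^sup>2)"
  shows "integrable M (\<lambda>x. u x * v x)"
proof (rule Bochner_Integration.integrable_bound)
  show "integrable M (\<lambda>x. (u x)\<^sup>2 + (v x)\<^sup>2)"
    using assms by simp
  have "\<bar>a * b\<bar> \<le> a\<^sup>2 + b\<^sup>2" for a b :: real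
    \<comment> \<open>The sum of squares dominates twice the absolute product; nonnegativity of that
      product allows the factor 2 to be dropped.\<close>
    using sum_squares_bound[of "\<bar>a\<bar>" "\<bar>b\<bar>"] abs_ge_zero[of "a * b"]
    unfolding power2_abs mult.assoc abs_mult[symmetric] by linarith
  then show "AE x in M. norm (u x * v x) \<le> norm ((u x)\<^sup>2 + (v x)\<^sup>2)"
    by auto
qed measurable

lemma square_integrable_diff:
  fixes u v :: "'a \<Rightarrow> real"
  assumes "u \<in> borel_measurable M" "v \<in> borel_measurable M"
    and "integrable M (\<lambda>x. (u x)\<^sup>2)" "integrable M (\<lambda>x. (v x)\<^sup>2)"
  shows "integrable M (\<lambda>x. (u x - v x)\<^sup>2)"
  using assms integrable_mult_of_square_integrable[OF assms]
  by (simp add: power2_diff mult.assoc)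

text \<open>Conditional Jensen for the square: conditioning maps L2 into L2. Finiteness of
  \<open>M\<close> gives integrability of \<open>Y\<close> itself.\<close>

lemma (in finite_measure_subalgebra) square_integrable_real_cond_exp:
  assumes [measurable]: "Y \<in> borel_measurable M" and "integrable M (\<lambda>x. (Y x)\<^sup>2)"
  shows "integrable M (\<lambda>x. (real_cond_exp M F Y x)\<^sup>2)"
proof (rule integrable_convex_cond_exp[where I = UNIV])
  show "integrable M Y"
    using assms by (rule square_integrable_imp_integrable)
  show "convex_on UNIV (\<lambda>x::real. x\<^sup>2)"
    by (rule convex_power2)
qed (use assms in auto)

text \<open>Conditional expectations are orthogonal projections in L2, here onto nested subspaces:
  the difference of the two projections of \<open>Y\<close> is orthogonal to everything square
  integrable and \<open>G\<close>-measurable.\<close>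

lemma (in finite_measure) cond_exp_pythagoras:
  assumes F: "subalgebra M F" and G: "subalgebra F G"
    and Y[measurable]: "Y \<in> borel_measurable M" and Y2: "integrable M (\<lambda>x. (Y x)\<^sup>2)"
    and W: "W \<in> borel_measurable G" and W2: "integrable M (\<lambda>x. (W x)\<^sup>2)"
  shows "(\<integral>x. (W x - real_cond_exp M F Y x)\<^sup>2 \<partial>M) =
    (\<integral>x. (W x - real_cond_exp M G Y x)\<^sup>2 \<partial>M) +
    (\<integral>x. (real_cond_exp M G Y x - real_cond_exp M F Y x)\<^sup>2 \<partial>M)"
proof -
  have MG: "subalgebra M G"
    using F G by (auto simp: subalgebra_def)
  interpret F: finite_measure_subalgebra M F
    by unfold_locales (rule F)
  interpret G: finite_measure_subalgebra M G
    by unfold_locales (rule MG)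
  define A where "A = real_cond_exp M F Y"
  define B where "B = real_cond_exp M G Y"
  define D where "D x = W x - B x" for x
  have [measurable]: "A \<in> borel_measurable M" "B \<in> borel_measurable M"
    unfolding A_def B_def by (auto intro: borel_measurable_cond_exp2)
  have [measurable]: "W \<in> borel_measurable M"
    by (rule measurable_from_subalg[OF MG W])
  have A2: "integrable M (\<lambda>x. (A x)\<^sup>2)" and B2: "integrable M (\<lambda>x. (B x)\<^sup>2)"
    unfolding A_def B_def
    by (intro F.square_integrable_real_cond_exp G.square_integrable_real_cond_exp Y Y2)+
  have [measurable]: "D \<in> borel_measurable M"
    unfolding D_def by measurable
  have D2: "integrable M (\<lambda>x. (D x)\<^sup>2)"
    unfolding D_def using W2 B2 by (intro square_integrable_diff) auto
  have DG: "D \<in> borel_measurable G"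
    unfolding D_def B_def using W by (intro borel_measurable_diff borel_measurable_cond_exp)
  \<comment> \<open>The nesting of \<open>G\<close> in \<open>F\<close> is what makes
    \<open>D\<close> an admissible test function for conditioning on \<open>F\<close> as
    well.\<close>
  have DF: "D \<in> borel_measurable F"
    by (rule measurable_from_subalg[OF G DG])
  have DY: "integrable M (\<lambda>x. D x * Y x)"
    using D2 Y2 by (intro integrable_mult_of_square_integrable) auto
  have DA: "integrable M (\<lambda>x. D x * A x)" "(\<integral>x. D x * A x \<partial>M) = (\<integral>x. D x * Y x \<partial>M)"
    unfolding A_def by (rule F.real_cond_exp_intg[OF DY DF Y])+
  have DB: "integrable M (\<lambda>x. D x * B x)" "(\<integral>x. D x * B x \<partial>M) = (\<integral>x. D x * Y x \<partial>M)"
    unfolding B_def by (rule G.real_cond_exp_intg[OF DY DG Y])+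
  have BA2: "integrable M (\<lambda>x. (B x - A x)\<^sup>2)"
    using A2 B2 by (intro square_integrable_diff) auto
  \<comment> \<open>The cross term is kept as a difference of products so that \<open>DA\<close> and
    \<open>DB\<close> apply directly; both products integrate to the integral of
    \<open>D x * Y x\<close> and cancel.\<close>
  have "(\<integral>x. (W x - A x)\<^sup>2 \<partial>M) =
      (\<integral>x. (D x)\<^sup>2 + (B x - A x)\<^sup>2 + 2 * (D x * B x - D x * A x) \<partial>M)"
    by (intro Bochner_Integration.integral_cong)
      (auto simp: D_def power2_eq_square algebra_simps)
  also have "\<dots> = (\<integral>x. (D x)\<^sup>2 \<partial>M) + (\<integral>x. (B x - A x)\<^sup>2 \<partial>M)"
    using D2 BA2 DA DB by simp
  finally show ?thesis
    by (simp add: A_def B_def D_def)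
qed

lemma subalgebra_vimage_algebra:
  assumes "Z \<in> borel_measurable M"
  shows "subalgebra M (vimage_algebra (space M) Z borel)"
  using assms sets_image_in_sets[OF refl assms] by (simp add: subalgebra_def)

theorem proposition1:
  fixes \<X> :: "(real ^ 'd) set"
    and P :: "((real ^ 'd) \<times> real) measure"
    and f :: "real ^ 'd \<Rightarrow> real"
    and h :: "real \<Rightarrow> real"
  assumes "prob_space P"
    and "sets P = sets (sample_space \<X>)"
    and "f \<in> restrict_space borel \<X> \<rightarrow>\<^sub>M restrict_space borel {0..1}"
    and "h \<in> restrict_space borel {0..1} \<rightarrow>\<^sub>M restrict_space borel {0..1}"
  shows "recal_risk P h f = cal_risk P h f + sha_risk P h f"
proof -
  interpret prob_space P by fact
  note [measurable_cong] = assms(2)[unfolded sample_space_def]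
  note [measurable] = assms(3,4)
  let ?F = "vimage_algebra (space P) (f \<circ> fst) borel"
  let ?G = "vimage_algebra (space P) (h \<circ> f \<circ> fst) borel"
  have space_P: "space P = \<X> \<times> {0, 1}"
    using sets_eq_imp_space_eq[OF assms(2)]
    by (simp add: sample_space_def space_pair_measure space_restrict_space)
  have fP: "f \<circ> fst \<in> P \<rightarrow>\<^sub>M restrict_space borel {0..1}"
    unfolding comp_def by measurable
  have f_range: "f (fst \<omega>) \<in> {0..1}" if "\<omega> \<in> space P" for \<omega>
    using measurable_space[OF fP that] by (simp add: space_restrict_space)
  have h_range: "h (f (fst \<omega>)) \<in> {0..1}" if "\<omega> \<in> space P" for \<omega>
    using measurable_space[OF assms(4)] f_range[OF that] by (simp add: space_restrict_space)
  have F: "subalgebra P ?F"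
    using fP by (intro subalgebra_vimage_algebra) (simp add: measurable_restrict_space2_iff)
  \<comment> \<open>\<open>h\<close> is measurable only on the unit interval, so the codomain must
    be restricted before composing.\<close>
  have "f \<circ> fst \<in> ?F \<rightarrow>\<^sub>M restrict_space borel {0..1}"
    using f_range by (intro measurable_restrict_space2 measurable_vimage_algebra1) auto
  from measurable_comp[OF this assms(4)] have "h \<circ> f \<circ> fst \<in> borel_measurable ?F"
    by (simp add: measurable_restrict_space2_iff comp_assoc)
  \<comment> \<open>\<open>?F\<close> now serves as the ambient measure: as a measurable function of
    the forecast, the recalibrated forecast generates a coarser \<sigma>-algebra.\<close>
  from subalgebra_vimage_algebra[OF this] have G: "subalgebra ?F ?G"
    by simp
  have "snd \<in> P \<rightarrow>\<^sub>M count_space {0, 1}"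
    \<comment> \<open>The label space is discrete, so its inclusion into the reals is
      measurable.\<close>
    by measurable
  then have Y: "snd \<in> borel_measurable P"
    by (rule measurable_compose) simp
  have W: "(h \<circ> f \<circ> fst) \<in> borel_measurable ?G"
    by (intro measurable_vimage_algebra1) auto
  have WP: "(h \<circ> f \<circ> fst) \<in> borel_measurable P"
    using measurable_from_subalg[OF F] measurable_from_subalg[OF G] W by blast
  \<comment> \<open>Labels, and likewise recalibrated forecasts below, lie in the unit interval, so
    their squares are bounded by 1 under a probability measure.\<close>
  have Y2: "integrable P (\<lambda>\<omega>. (snd \<omega>)\<^sup>2)"
    using Y by (intro integrable_const_bound[where B = 1]) (auto simp: space_P intro!: AE_I2)
  have W2: "integrable P (\<lambda>\<omega>. ((h \<circ> f \<circ> fst) \<omega>)\<^sup>2)"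
    using WP h_range by (intro integrable_const_bound[where B = 1] borel_measurable_power)
      (auto simp: power_le_one comp_def)
  show ?thesis
    using cond_exp_pythagoras[OF F G Y Y2 W W2]
    by (simp add: recal_risk_def cal_risk_def sha_risk_def cond_exp_given_def)
qed

end
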